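(* For $n\ge1$ let \[ P_{n}(y,z,s,t)=P_{n}^{(\mathrm{lpk},\mathrm{ilpk},\mathrm{des},\mathrm{ides})}(y,z,s,t)=\sum_{\pi\in\mathfrak{S}_{n}}y^{\mathrm{lpk}(\pi)}z^{\mathrm{ilpk}(\pi)}s^{\mathrm{des}(\pi)}t^{\mathrm{ides}(\pi)}. \] Then, as formal power series, \begin{multline*} \frac{1}{(1-s)(1-t)}+\sum_{n=1}^{\infty}\frac{(1+ys)^{n}(1+zt)^{n}P_{n}\left(\frac{(1+y)^{2}s}{(y+s)(1+ys)},\frac{(1+z)^{2}t}{(z+t)(1+zt)},\frac{y+s}{1+ys},\frac{z+t}{1+zt}\right)}{(1-s)^{n+1}(1-t)^{n+1}}x^{n}\\ =\sum_{i,j=0}^{\infty}\frac{(1+yx)^{i(j+1)}(1+zx)^{(i+1)j}}{(1-yzx)^{ij}(1-x)^{(i+1)(j+1)}}s^{i}t^{j}. \end{multline*}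
   Context: $\mathfrak{S}_n$ is the symmetric group on $[n]$. For $\pi\in\mathfrak{S}_n$: $i\in[n-1]$ is a descent if $\pi(i)>\pi(i+1)$ and $\mathrm{des}(\pi)$ is the number of descents; $i$ with $2\le i\le n-1$ is a peak if $\pi(i-1)<\pi(i)>\pi(i+1)$; $i\in[n-1]$ is a left peak if $i$ is a peak, or if $i=1$ and $\pi(1)>\pi(2)$; $\mathrm{lpk}(\pi)$ is the number of left peaks. Inverse statistics are $\mathrm{ides}(\pi)=\mathrm{des}(\pi^{-1})$, $\mathrm{ilpk}(\pi)=\mathrm{lpk}(\pi^{-1})$. *)

theory Defs
  imports "HOL-Computational_Algebra.Computational_Algebra" "HOL-Combinatorics.Combinatorics"
begin

text \<open>
  The elements of the symmetric group on \<open>{1..n}\<close> are the functions \<open>\<pi> :: nat \<Rightarrow> nat\<close> with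
  \<open>\<pi> permutes {1..n}\<close>; the inverse permutation is \<open>inv \<pi>\<close>.
\<close>

definition is_descent :: "nat \<Rightarrow> (nat \<Rightarrow> nat) \<Rightarrow> nat \<Rightarrow> bool" where
  "is_descent n \<pi> i \<longleftrightarrow> i \<in> {1..n-1} \<and> \<pi> i > \<pi> (i + 1)"

definition is_peak :: "nat \<Rightarrow> (nat \<Rightarrow> nat) \<Rightarrow> nat \<Rightarrow> bool" where
  "is_peak n \<pi> i \<longleftrightarrow> i \<in> {2..n-1} \<and> \<pi> (i - 1) < \<pi> i \<and> \<pi> i > \<pi> (i + 1)"

definition is_left_peak :: "nat \<Rightarrow> (nat \<Rightarrow> nat) \<Rightarrow> nat \<Rightarrow> bool" where
  "is_left_peak n \<pi> i \<longleftrightarrow> i \<in> {1..n-1} \<and> (is_peak n \<pi> i \<or> (i = 1 \<and> \<pi> 1 > \<pi> 2))"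

definition des :: "nat \<Rightarrow> (nat \<Rightarrow> nat) \<Rightarrow> nat" where
  "des n \<pi> = card {i. is_descent n \<pi> i}"

definition lpk :: "nat \<Rightarrow> (nat \<Rightarrow> nat) \<Rightarrow> nat" where
  "lpk n \<pi> = card {i. is_left_peak n \<pi> i}"

definition ides :: "nat \<Rightarrow> (nat \<Rightarrow> nat) \<Rightarrow> nat" where
  "ides n \<pi> = des n (inv \<pi>)"

definition ilpk :: "nat \<Rightarrow> (nat \<Rightarrow> nat) \<Rightarrow> nat" where
  "ilpk n \<pi> = lpk n (inv \<pi>)"

definition lpk_des_poly :: "nat \<Rightarrow> 'a \<Rightarrow> 'a \<Rightarrow> 'a \<Rightarrow> 'a \<Rightarrow> 'a::comm_semiring_1" where
  "lpk_des_poly n y z s t =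
     (\<Sum>\<pi> | \<pi> permutes {1..n}. y ^ lpk n \<pi> * z ^ ilpk n \<pi> * s ^ des n \<pi> * t ^ ides n \<pi>)"


text \<open>
  The ambient ring is \<open>\<rat>(y,z)[[s]][[t]][[x]]\<close>: formal power series in \<open>s\<close>, \<open>t\<close>, \<open>x\<close> over the
  field of rational functions in \<open>y\<close> and \<open>z\<close>. Since \<open>y\<close> and \<open>z\<close> are invertible, so are \<open>y + s\<close>
  and \<open>z + t\<close>, which occur as denominators (they are not units in \<open>\<rat>[[y,z,s,t,x]]\<close>).
  The coefficient of \<open>x^a t^b s^c\<close> in \<open>f\<close> is \<open>f $ a $ b $ c\<close>.
\<close>

type_synonym ratfun2 = "rat poly poly fract"
type_synonym series = "ratfun2 fps fps fps"

definition var_y :: series where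
  "var_y = fps_const (fps_const (fps_const (to_fract [:[:0, 1:]:])))"

definition var_z :: series where
  "var_z = fps_const (fps_const (fps_const (to_fract [:0, 1:])))"

definition var_s :: series where
  "var_s = fps_const (fps_const fps_X)"

definition var_t :: series where
  "var_t = fps_const fps_X"

definition var_x :: series where
  "var_x = fps_X"


text \<open>
  Infinite sums of formal power series in all three variables simultaneously. (The library's
  topology on \<open>'a fps fps fps\<close> only sees the outermost variable, so \<open>\<Sum>i. s^i\<close> diverges there.)
  A family is summable if every monomial occurs in only finitely many members; the sum is then
  taken coefficientwise.
\<close>

definition fps3_summable :: "('i \<Rightarrow> 'a::comm_monoid_add fps fps fps) \<Rightarrow> 'i set \<Rightarrow> bool" where
  "fps3_summable f A \<longleftrightarrow> (\<forall>a b c. finite {k \<in> A. f k $ a $ b $ c \<noteq> 0})"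

definition fps3_sum :: "('i \<Rightarrow> 'a::comm_monoid_add fps fps fps) \<Rightarrow> 'i set \<Rightarrow> 'a fps fps fps" where
  "fps3_sum f A = Abs_fps (\<lambda>a. Abs_fps (\<lambda>b. Abs_fps (\<lambda>c.
     \<Sum>k \<in> {k \<in> A. f k $ a $ b $ c \<noteq> 0}. f k $ a $ b $ c)))"


text \<open>
  Division in nested power series rings is total; it is genuine division by units, i.e. by series
  with nonzero constant term, and the denominators used are of this form.
\<close>

lemma fps3_mult_inverse:
  fixes g :: "'a::field fps fps fps"
  assumes "g $ 0 $ 0 $ 0 \<noteq> 0"
  shows "g * inverse g = 1"
proof -
  have 1: "g $ 0 $ 0 * inverse (g $ 0 $ 0) = 1"
    using assms inverse_mult_eq_1' by blast
  have 2: "g $ 0 * inverse (g $ 0) = 1"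
    unfolding fps_inverse_def[of "g $ 0"] by (rule fps_right_inverse) (use 1 in simp)
  show ?thesis
    unfolding fps_inverse_def[of g] by (rule fps_right_inverse) (use 2 in simp)
qed

lemma fps3_divide_unit:
  fixes f g :: "'a::field fps fps fps"
  assumes "g $ 0 $ 0 $ 0 \<noteq> 0"
  shows "f / g = f * inverse g"
proof -
  have "g $ 0 \<noteq> 0" using assms by auto
  then have "subdegree g = 0" by (simp add: subdegree_eq_0)
  then show ?thesis by (simp add: fps_divide_def)
qed

lemma denominators_units:
  "(1 - var_s) $ 0 $ 0 $ 0 \<noteq> 0" "(1 - var_t) $ 0 $ 0 $ 0 \<noteq> 0"
  "(1 + var_y * var_s) $ 0 $ 0 $ 0 \<noteq> 0" "(1 + var_z * var_t) $ 0 $ 0 $ 0 \<noteq> 0"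
  "(var_y + var_s) $ 0 $ 0 $ 0 \<noteq> 0" "(var_z + var_t) $ 0 $ 0 $ 0 \<noteq> 0"
  "(1 - var_y * var_z * var_x) $ 0 $ 0 $ 0 \<noteq> 0" "(1 - var_x) $ 0 $ 0 $ 0 \<noteq> 0"
  by (simp_all add: var_y_def var_z_def var_s_def var_t_def var_x_def)

end

theory Submission
  imports Defs
begin

text \<open>
  Take the alphabet \<open>0 < 1' < 1 < 2' < 2 < \<dots> < i' < i\<close> with a factor \<open>y\<close> for every primed
  letter. For a permutation \<open>\<pi>\<close> consider the weakly increasing words \<open>a\<^sub>1 \<le> \<dots> \<le> a\<^sub>n\<close> in which
  \<open>a\<^sub>k = a\<^sub>k\<^sub>+\<^sub>1\<close> is allowed for an unprimed letter only if \<open>k\<close> is an ascent of \<open>\<pi>\<close>, and for a primed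
  letter only if \<open>k\<close> is a descent. Weighting their number by \<open>s\<^sup>i\<close> and summing over \<open>i\<close> gives
  \<open>(1 + ys)\<^sup>n / (1 - s)\<^sup>n\<^sup>+\<^sup>1\<close> times the monomial of \<open>\<pi>\<close> in \<open>P\<^sub>n\<close> with the substituted arguments: by
  a recursion in \<open>n\<close>, an ascent contributes \<open>1 + ys\<close>, a descent after a descent \<open>y + s\<close>, and a
  descent after an ascent \<open>(1 + y)\<^sup>2 s / (1 + ys)\<close>, up to the factor \<open>1 / (1 - s)\<close>.

  It remains to sum the product of these counts for \<open>\<pi>\<close> and \<open>\<pi>\<^sup>-\<^sup>1\<close> over all \<open>\<pi>\<close>. Standardization
  turns a pair of \<open>\<pi>\<close> and an admissible word for \<open>\<pi>\<^sup>-\<^sup>1\<close> into an arbitrary word \<open>w\<close> over the second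
  alphabet. An admissible word for \<open>\<pi>\<close> then cuts \<open>w\<close> into consecutive blocks, one for each
  letter of the first alphabet, that are increasing or decreasing according to the type of the
  letter. The generating function is therefore a product over pairs of letters, with factor
  \<open>1 / (1 - cx)\<close> for letters of the same type and \<open>1 + cx\<close> for letters of different type, where
  \<open>c\<close> is the product of the two weights.
\<close>

section \<open>Words compatible with a descent set\<close>

text \<open>
  The letter \<open>c\<close> encodes the unprimed letter \<open>c/2\<close> if \<open>c\<close> is even and the primed letter \<open>((c+1)/2)'\<close>
  if \<open>c\<close> is odd, so the alphabet \<open>0, 1', 1, \<dots>, i', i\<close> is \<open>{..<2 * i + 1}\<close>.
\<close>

definition letter_weight :: "'a \<Rightarrow> nat \<Rightarrow> 'a::comm_ring_1" where
  "letter_weight y c = (if odd c then y else 1)"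

text \<open>
  The weighted number of compatible words of length \<open>n\<close> over \<open>{..<m}\<close>, by the last letter; the
  value of \<open>D 0\<close> does not matter, as \<open>wcount y D m 0 = 1\<close> for every \<open>m\<close>.
\<close>

fun wcount :: "'a \<Rightarrow> (nat \<Rightarrow> bool) \<Rightarrow> nat \<Rightarrow> nat \<Rightarrow> 'a::comm_ring_1" where
  "wcount y D 0 n = (if n = 0 then 1 else 0)"
| "wcount y D (Suc m) 0 = 1"
| "wcount y D (Suc m) (Suc n) = wcount y D m (Suc n)
     + letter_weight y m * (if D n = odd m then wcount y D (Suc m) n else wcount y D m n)"

lemma wcount_0 [simp]: "wcount y D m 0 = 1"
  by (cases m) auto

lemma wcount_Suc:
  "wcount y D (Suc m) (Suc n) = wcount y D m (Suc n)
     + letter_weight y m * (if n = 0 \<or> D n = odd m then wcount y D (Suc m) n else wcount y D m n)"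
  by (cases n) auto

lemma wcount_cong:
  assumes "\<And>k. 1 \<le> k \<Longrightarrow> k < n \<Longrightarrow> D k = D' k"
  shows "wcount y D m n = wcount y D' m n"
  using assms
proof (induction y D m n rule: wcount.induct)
  case (3 y D m n)
  have e: "n = 0 \<or> D n = D' n" using 3(4) by (cases n) auto
  have 1: "wcount y D m (Suc n) = wcount y D' m (Suc n)" using 3 by simp
  have "D n = odd m \<Longrightarrow> wcount y D (Suc m) n = wcount y D' (Suc m) n"
       "D n \<noteq> odd m \<Longrightarrow> wcount y D m n = wcount y D' m n"
    using 3 by simp_all
  then show ?case using e unfolding wcount_Suc 1 by auto
qed auto

definition compat_words :: "(nat \<Rightarrow> bool) \<Rightarrow> nat \<Rightarrow> nat \<Rightarrow> (nat \<Rightarrow> nat) set" where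
  "compat_words D m n = {a \<in> {1..n} \<rightarrow>\<^sub>E {..<m}.
     \<forall>k\<in>{1..<n}. a k \<le> a (Suc k) \<and> (a k = a (Suc k) \<longrightarrow> D k = odd (a k))}"

definition word_weight :: "'a \<Rightarrow> nat \<Rightarrow> (nat \<Rightarrow> nat) \<Rightarrow> 'a::comm_ring_1" where
  "word_weight y n a = (\<Prod>k=1..n. letter_weight y (a k))"

lemma finite_compat_words [simp]: "finite (compat_words D m n)"
  unfolding compat_words_def by (rule finite_subset[OF _ finite_PiE[of "{1..n}" "\<lambda>_. {..<m}"]]) auto

lemma compat_wordsD:
  assumes "a \<in> compat_words D m n"
  shows "\<And>k. k \<in> {1..n} \<Longrightarrow> a k < m" "\<And>k. k \<notin> {1..n} \<Longrightarrow> a k = undefined"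
    "\<And>k. 1 \<le> k \<Longrightarrow> k < n \<Longrightarrow> a k \<le> a (Suc k)"
    "\<And>k. 1 \<le> k \<Longrightarrow> k < n \<Longrightarrow> a k = a (Suc k) \<Longrightarrow> D k = odd (a k)"
  using assms by (auto simp: compat_words_def PiE_def extensional_def Pi_def)

lemma compat_wordsI:
  assumes "\<And>k. k \<in> {1..n} \<Longrightarrow> a k < m" "\<And>k. k \<notin> {1..n} \<Longrightarrow> a k = undefined"
    "\<And>k. 1 \<le> k \<Longrightarrow> k < n \<Longrightarrow> a k \<le> a (Suc k)"
    "\<And>k. 1 \<le> k \<Longrightarrow> k < n \<Longrightarrow> a k = a (Suc k) \<Longrightarrow> D k = odd (a k)"
  shows "a \<in> compat_words D m n"
  using assms by (auto simp: compat_words_def PiE_def extensional_def Pi_def)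

lemma compat_words_mono:
  assumes "a \<in> compat_words D m n" "1 \<le> i" "i \<le> j" "j \<le> n"
  shows "a i \<le> a j"
  using assms(3,4)
proof (induction j rule: dec_induct)
  case (step j)
  then show ?case using compat_wordsD(3)[OF assms(1), of j] assms(2) by fastforce
qed simp

lemma compat_words_0: "compat_words D m 0 = {\<lambda>_. undefined}"
  by (auto simp: compat_words_def)

text \<open>Split by the last letter: if it is below \<open>m\<close>, monotonicity keeps all
  letters below \<open>m\<close>. If it is \<open>m\<close>, deleting it leaves a prefix that may
  end in \<open>m\<close> only where position \<open>n\<close> allows a repetition.\<close>

lemma compat_words_Suc:
  "compat_words D (Suc m) (Suc n) = compat_words D m (Suc n) \<union>
     (\<lambda>a. a(Suc n := m)) ` (if n = 0 \<or> D n = odd m then compat_words D (Suc m) n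
                             else compat_words D m n)" (is "?L = ?R1 \<union> ?f ` ?R2")
proof (intro equalityI subsetI)
  fix a assume a: "a \<in> ?L"
  show "a \<in> ?R1 \<union> ?f ` ?R2"
  proof (cases "a (Suc n) = m")
    case False
    then have *: "a (Suc n) < m" using compat_wordsD(1)[OF a, of "Suc n"] by auto
    have "a k < m" if "k \<in> {1..Suc n}" for k
      using compat_words_mono[OF a, of k "Suc n"] that * by auto
    then have "a \<in> ?R1" using compat_wordsD[OF a] by (intro compat_wordsI) auto
    then show ?thesis by blast
  next
    case True
    let ?b = "a(Suc n := undefined)"
    have b: "?b \<in> compat_words D (Suc m) n"
      using compat_wordsD[OF a] by (intro compat_wordsI) auto
    have "?b \<in> ?R2"
    proof (cases "n = 0 \<or> D n = odd m")
      case False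
      then have "a n \<noteq> a (Suc n)" using compat_wordsD(4)[OF a, of n] True by auto
      then have "a n < m" using compat_wordsD(3)[OF a, of n] True False by auto
      then have "?b k < m" if "k \<in> {1..n}" for k
        using compat_words_mono[OF a, of k n] that by auto
      then have "?b \<in> compat_words D m n"
        using compat_wordsD[OF b] by (intro compat_wordsI) auto
      then show ?thesis using False by simp
    qed (use b in simp)
    moreover have "a = ?f ?b" using True by auto
    ultimately show ?thesis by blast
  qed
next
  fix a assume "a \<in> ?R1 \<union> ?f ` ?R2"
  then show "a \<in> ?L"
  proof
    assume a: "a \<in> ?R1"
    show ?thesis using compat_wordsD[OF a] by (intro compat_wordsI) (auto intro: less_SucI)
  next
    assume "a \<in> ?f ` ?R2"
    then obtain b where b: "b \<in> ?R2" and a: "a = b(Suc n := m)" by auto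
    have b': "b \<in> compat_words D (Suc m) n"
    proof (cases "n = 0 \<or> D n = odd m")
      case False
      then have "b \<in> compat_words D m n" using b by simp
      from compat_wordsD[OF this] show ?thesis by (intro compat_wordsI) (auto intro: less_SucI)
    qed (use b in simp)
    have "b n \<le> m \<and> (b n = m \<longrightarrow> D n = odd m)" if "n \<ge> 1"
      using b compat_wordsD(1)[of b D _ n n] that by (fastforce split: if_splits)
    then show ?thesis unfolding a using compat_wordsD[OF b']
      by (intro compat_wordsI) (auto simp: less_Suc_eq)
  qed
qed

lemma wcount_eq_sum_compat_words:
  "wcount y D m n = (\<Sum>a\<in>compat_words D m n. word_weight y n a)"
proof (induction y D m n rule: wcount.induct)
  case (1 y D n)
  have "compat_words D 0 n = {}" if "n > 0"
    using compat_wordsD(1)[of _ D 0 n n] that by auto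
  then show ?case by (auto simp: compat_words_0 word_weight_def)
next
  case (2 y D m)
  then show ?case by (simp add: compat_words_0 word_weight_def)
next
  case (3 y D m n)
  let ?R = "if n = 0 \<or> D n = odd m then compat_words D (Suc m) n else compat_words D m n"
  let ?f = "\<lambda>a. a(Suc n := m)"
  have fin: "finite ?R" by simp
  have und: "a (Suc n) = undefined" if "a \<in> ?R" for a
    using that compat_wordsD(2)[of a D _ n "Suc n"] by (auto split: if_splits)
  have inj: "inj_on ?f ?R"
    by (rule inj_onI, rule ext) (metis fun_upd_apply und)
  have disj: "compat_words D m (Suc n) \<inter> ?f ` ?R = {}"
    using compat_wordsD(1)[of _ D m "Suc n" "Suc n"] by fastforce
  have w: "word_weight y (Suc n) (?f a) = letter_weight y m * word_weight y n a" for a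
    by (simp add: word_weight_def mult.commute)
  have IH: "(if n = 0 \<or> D n = odd m then wcount y D (Suc m) n else wcount y D m n)
     = (\<Sum>a\<in>?R. word_weight y n a)"
    using 3 by (cases n) (auto simp: compat_words_0 word_weight_def)
  have "(\<Sum>a\<in>compat_words D (Suc m) (Suc n). word_weight y (Suc n) a)
    = (\<Sum>a\<in>compat_words D m (Suc n). word_weight y (Suc n) a)
      + (\<Sum>a\<in>?f ` ?R. word_weight y (Suc n) a)"
    unfolding compat_words_Suc by (rule sum.union_disjoint) (use fin disj in auto)
  also have "(\<Sum>a\<in>?f ` ?R. word_weight y (Suc n) a) = letter_weight y m * (\<Sum>a\<in>?R. word_weight y n a)"
    by (simp add: sum.reindex[OF inj] w sum_distrib_left del: if_split)
  finally show ?case unfolding wcount_Suc IH using 3(1) by simp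
qed

lemma wcount_fps_const:
  "wcount (fps_const y) D m n = fps_const (wcount y D m n)"
  by (induction y D m n rule: wcount.induct) (auto simp: letter_weight_def)

text \<open>The index \<open>k\<close> is the number of letters before the final block of letters
  \<open>m\<close>. Positions strictly inside the block must allow a repetition; position
  \<open>k\<close>, between a smaller letter and \<open>m\<close>, is unconstrained.\<close>

lemma wcount_last_block:
  "wcount y D (Suc m) n = (\<Sum>k\<le>n. if \<forall>l\<in>{k<..<n}. D l = odd m
      then letter_weight y m ^ (n - k) * wcount y D m k else 0)"
proof (induction n)
  case (Suc n)
  let ?T = "\<lambda>n k. if \<forall>l\<in>{k<..<n}. D l = odd m
      then letter_weight y m ^ (n - k) * wcount y D m k else 0"
  have *: "?T (Suc n) k = (if D n = odd m then letter_weight y m * ?T n k else 0)" if "k < n" for k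
  proof -
    have "{k<..<Suc n} = insert n {k<..<n}" using that by auto
    moreover have "Suc n - k = Suc (n - k)" using that by simp
    ultimately show ?thesis by (simp add: mult.assoc)
  qed
  have "(\<Sum>k\<le>Suc n. ?T (Suc n) k) = (\<Sum>k<n. ?T (Suc n) k) + ?T (Suc n) n + ?T (Suc n) (Suc n)"
    by (simp add: lessThan_Suc_atMost[symmetric])
  also have "(\<Sum>k<n. ?T (Suc n) k) = (if D n = odd m then letter_weight y m * (\<Sum>k<n. ?T n k) else 0)"
    using * by (simp add: sum_distrib_left)
  also have "?T (Suc n) n = letter_weight y m * wcount y D m n"
    by (auto simp: Suc_diff_le)
  also have "?T (Suc n) (Suc n) = wcount y D m (Suc n)" by simp
  finally have "(\<Sum>k\<le>Suc n. ?T (Suc n) k) = (if D n = odd m then letter_weight y m * (\<Sum>k<n. ?T n k) else 0)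
     + letter_weight y m * wcount y D m n + wcount y D m (Suc n)" .
  moreover have "wcount y D (Suc m) n = (\<Sum>k<n. ?T n k) + wcount y D m n"
    unfolding Suc.IH by (simp add: lessThan_Suc_atMost[symmetric])
  ultimately show ?case by (simp add: algebra_simps)
qed simp

section \<open>Standardization\<close>

text \<open>These are the descents of the standardization: equal odd letters are numbered from right
  to left and so count as descents.\<close>

definition superdesc :: "(nat \<Rightarrow> nat) \<Rightarrow> nat \<Rightarrow> bool" where
  "superdesc w k \<longleftrightarrow> w (Suc k) < w k \<or> w k = w (Suc k) \<and> odd (w k)"

text \<open>
  The order in which standardization numbers the positions of a word: equal even letters from left
  to right, equal odd letters from right to left.
\<close>

definition prec :: "(nat \<Rightarrow> nat) \<Rightarrow> nat \<Rightarrow> nat \<Rightarrow> bool" where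
  "prec w k l \<longleftrightarrow> w k < w l \<or> w k = w l \<and> (if odd (w k) then l < k else k < l)"

lemma prec_irrefl [simp]: "\<not> prec w k k"
  by (auto simp: prec_def)

lemma prec_trans: "prec w k l \<Longrightarrow> prec w l h \<Longrightarrow> prec w k h"
  by (auto simp: prec_def split: if_splits)

lemma prec_total: "k \<noteq> l \<Longrightarrow> prec w k l \<or> prec w l k"
  by (auto simp: prec_def)

lemma prec_asym: "prec w k l \<Longrightarrow> \<not> prec w l k"
  using prec_trans prec_irrefl by blast

lemma superdesc_iff_prec: "superdesc w k \<longleftrightarrow> prec w (Suc k) k"
  by (auto simp: superdesc_def prec_def)

text \<open>The standardization of \<open>w\<close>. Counting \<open>k\<close> itself makes ranks
  start at 1; the identity outside \<open>{1..n}\<close> fits the convention of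
  \<open>permutes\<close>.\<close>

definition rank :: "nat \<Rightarrow> (nat \<Rightarrow> nat) \<Rightarrow> nat \<Rightarrow> nat" where
  "rank n w k = (if k \<in> {1..n} then card {l \<in> {1..n}. l = k \<or> prec w l k} else k)"

lemma rank_less:
  assumes "k \<in> {1..n}" "l \<in> {1..n}" "prec w k l"
  shows "rank n w k < rank n w l"
proof -
  have "{h \<in> {1..n}. h = k \<or> prec w h k} \<subset> {h \<in> {1..n}. h = l \<or> prec w h l}"
  proof (rule psubsetI)
    show "{h \<in> {1..n}. h = k \<or> prec w h k} \<subseteq> {h \<in> {1..n}. h = l \<or> prec w h l}"
      using assms(3) prec_trans by blast
    have "l \<notin> {h \<in> {1..n}. h = k \<or> prec w h k}" using assms(3) prec_asym by auto
    then show "{h \<in> {1..n}. h = k \<or> prec w h k} \<noteq> {h \<in> {1..n}. h = l \<or> prec w h l}"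
      using assms(2) by blast
  qed
  then have "card {h \<in> {1..n}. h = k \<or> prec w h k} < card {h \<in> {1..n}. h = l \<or> prec w h l}"
    by (intro psubset_card_mono) auto
  then show ?thesis using assms by (simp add: rank_def)
qed

lemma rank_less_iff:
  assumes "k \<in> {1..n}" "l \<in> {1..n}"
  shows "rank n w k < rank n w l \<longleftrightarrow> prec w k l"
proof
  assume less: "rank n w k < rank n w l"
  then have "\<not> prec w l k" using rank_less[OF assms(2,1)] by fastforce
  then show "prec w k l" using prec_total[of k l w] less by auto
qed (rule rank_less[OF assms])

lemma rank_permutes: "rank n w permutes {1..n}"
proof (rule bij_imp_permutes)
  have inj: "inj_on (rank n w) {1..n}"
    by (rule inj_onI) (metis rank_less prec_total less_irrefl)
  have "rank n w k \<in> {1..n}" if k: "k \<in> {1..n}" for k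
  proof -
    have "card {l \<in> {1..n}. l = k \<or> prec w l k} \<le> card {1..n}" by (intro card_mono) auto
    moreover have "card {l \<in> {1..n}. l = k \<or> prec w l k} > 0"
      using k by (subst card_gt_0_iff) auto
    ultimately show ?thesis using k by (simp add: rank_def)
  qed
  then have "rank n w ` {1..n} \<subseteq> {1..n}" by blast
  then show "bij_betw (rank n w) {1..n} {1..n}"
    using inj unfolding bij_betw_def by (intro conjI endo_inj_surj) auto
qed (auto simp: rank_def)

text \<open>The relative order of the values determines a permutation, because \<open>p k\<close> is
  the number of \<open>l\<close> with \<open>p l \<le> p k\<close>.\<close>

lemma permutes_eq_rank:
  assumes p: "p permutes {1..n}"
    and mono: "\<And>k l. k \<in> {1..n} \<Longrightarrow> l \<in> {1..n} \<Longrightarrow> p k < p l \<longleftrightarrow> prec w k l"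
  shows "p = rank n w"
proof
  fix k show "p k = rank n w k"
  proof (cases "k \<in> {1..n}")
    case True
    have "{l \<in> {1..n}. l = k \<or> prec w l k} = {l \<in> {1..n}. p l \<le> p k}"
      using mono[OF _ True] permutes_inj[OF p] True by (auto simp: le_less inj_eq)
    then have "card {l \<in> {1..n}. l = k \<or> prec w l k} = card {l \<in> {1..n}. p l \<le> p k}"
      by simp
    also have "\<dots> = card (p ` {l \<in> {1..n}. p l \<le> p k})"
      using permutes_inj[OF p] by (simp add: card_image inj_on_subset)
    also have "p ` {l \<in> {1..n}. p l \<le> p k} = {1..p k}"
    proof (intro equalityI subsetI)
      fix i assume "i \<in> p ` {l \<in> {1..n}. p l \<le> p k}"
      then show "i \<in> {1..p k}" using permutes_in_image[OF p] by auto
    next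
      fix i assume i: "i \<in> {1..p k}"
      moreover have "p k \<in> {1..n}" using permutes_in_image[OF p] True by blast
      ultimately have "i \<in> {1..n}" by auto
      then obtain l where "l \<in> {1..n}" "i = p l" using permutes_image[OF p] by blast
      then show "i \<in> p ` {l \<in> {1..n}. p l \<le> p k}" using i by auto
    qed
    finally show ?thesis using True by (simp add: rank_def)
  next
    case False
    then show ?thesis using permutes_not_in[OF p] by (auto simp: rank_def)
  qed
qed

definition perm_desc :: "(nat \<Rightarrow> nat) \<Rightarrow> nat \<Rightarrow> bool" where
  "perm_desc p k \<longleftrightarrow> p (Suc k) < p k"

text \<open>Visiting the positions in the order \<open>inv p 1, inv p 2, ...\<close> spells
  \<open>a\<close>. Where \<open>a\<close> repeats a letter, \<open>inv p\<close> descends exactly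
  if the letter is odd, which is the tie rule of \<open>prec\<close>; transitivity extends this from
  neighbours to all pairs.\<close>

lemma prec_of_compat_word:
  assumes p: "p permutes {1..n}" and a: "a \<in> compat_words (perm_desc (inv p)) m n"
    and w: "\<And>k. k \<in> {1..n} \<Longrightarrow> w k = a (p k)"
    and kl: "k \<in> {1..n}" "l \<in> {1..n}"
  shows "prec w k l \<longleftrightarrow> p k < p l"
proof -
  have inv: "inv p i \<in> {1..n}" if "i \<in> {1..n}" for i
    using permutes_in_image[OF permutes_inv[OF p]] that by blast
  have w': "w (inv p i) = a i" if "i \<in> {1..n}" for i
    using w[OF inv[OF that]] permutes_inverses(1)[OF p] by simp
  have step: "prec w (inv p i) (inv p (Suc i))" if i: "1 \<le> i" "i < n" for i
  proof -
    have "inv p i \<noteq> inv p (Suc i)"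
      using permutes_inj[OF permutes_inv[OF p]] by (simp add: inj_eq)
    moreover have "w (inv p i) = a i" "w (inv p (Suc i)) = a (Suc i)" using i w' by auto
    ultimately show ?thesis
      using compat_wordsD(3,4)[OF a i] by (auto simp: prec_def perm_desc_def)
  qed
  have chain: "prec w (inv p i) (inv p j)" if "1 \<le> i" "Suc i \<le> j" "j \<le> n" for i j
    using that(2,3)
  proof (induction j rule: dec_induct)
    case base
    then show ?case using step that by simp
  next
    case (step j)
    have "prec w (inv p j) (inv p (Suc j))" using \<open>1 \<le> i\<close> step.hyps step.prems
      by (intro \<open>\<And>i. 1 \<le> i \<Longrightarrow> i < n \<Longrightarrow> prec w (inv p i) (inv p (Suc i))\<close>) auto
    then show ?case using step by (auto intro: prec_trans)
  qed
  have *: "prec w k l" if "k \<in> {1..n}" "l \<in> {1..n}" "p k < p l" for k l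
  proof -
    have "p k \<in> {1..n}" "p l \<in> {1..n}" using permutes_in_image[OF p] that by blast+
    then show ?thesis using chain[of "p k" "p l"] that(3) permutes_inverses(2)[OF p] by simp
  qed
  show ?thesis
    using *[of k l] *[of l k] kl prec_asym[of w k l] permutes_inj[OF p]
    by (metis inj_eq linorder_neqE_nat prec_irrefl)
qed

text \<open>Sorting by rank yields a weakly increasing word, and the tie rule of \<open>prec\<close>
  becomes the repetition condition.\<close>

lemma compat_word_of_rank:
  assumes w: "w \<in> {1..n} \<rightarrow>\<^sub>E {..<m}"
  shows "restrict (w \<circ> inv (rank n w)) {1..n} \<in> compat_words (perm_desc (inv (rank n w))) m n"
proof -
  let ?p = "rank n w"
  note p = rank_permutes[of n w]
  have inv: "inv ?p i \<in> {1..n}" if "i \<in> {1..n}" for i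
    using permutes_in_image[OF permutes_inv[OF p]] that by blast
  have *: "prec w (inv ?p k) (inv ?p (Suc k))" if "1 \<le> k" "k < n" for k
    using rank_less_iff[of "inv ?p k" n "inv ?p (Suc k)" w] inv[of k] inv[of "Suc k"] that
      permutes_inverses(1)[OF p] by auto
  show ?thesis
  proof (rule compat_wordsI)
    fix k assume k: "1 \<le> k" "k < n"
    show "restrict (w \<circ> inv ?p) {1..n} k \<le> restrict (w \<circ> inv ?p) {1..n} (Suc k)"
      using *[OF k] k by (auto simp: prec_def)
    assume "restrict (w \<circ> inv ?p) {1..n} k = restrict (w \<circ> inv ?p) {1..n} (Suc k)"
    then show "perm_desc (inv ?p) k = odd (restrict (w \<circ> inv ?p) {1..n} k)"
      using *[OF k] k by (auto simp: prec_def perm_desc_def split: if_splits)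
  qed (use inv w in \<open>auto simp: PiE_def Pi_def\<close>)
qed

text \<open>The bijection sends \<open>(p, a)\<close> to the word \<open>a \<circ> p\<close>; its
  inverse takes \<open>w\<close> to its standardization and its sorted letters. Letters are only
  permuted, so the weight is kept, and the descents of \<open>p\<close> become
  \<open>superdesc w\<close>.\<close>

lemma standardization:
  "(\<Sum>p | p permutes {1..n}. wcount y (perm_desc p) q n * wcount z (perm_desc (inv p)) m n)
   = (\<Sum>w\<in>{1..n} \<rightarrow>\<^sub>E {..<m}. word_weight z n w * wcount y (superdesc w) q n)"
proof -
  let ?P = "{p. p permutes {1..n}}"
  let ?S = "SIGMA p:?P. compat_words (perm_desc (inv p)) m n"
  have "(\<Sum>p\<in>?P. wcount y (perm_desc p) q n * wcount z (perm_desc (inv p)) m n)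
    = (\<Sum>p\<in>?P. \<Sum>a\<in>compat_words (perm_desc (inv p)) m n.
         word_weight z n a * wcount y (perm_desc p) q n)"
    by (simp add: wcount_eq_sum_compat_words[of z] sum_distrib_left mult.commute)
  also have "\<dots> = (\<Sum>(p, a)\<in>?S. word_weight z n a * wcount y (perm_desc p) q n)"
    by (rule sum.Sigma) (auto simp: finite_permutations)
  also have "\<dots> = (\<Sum>w\<in>{1..n} \<rightarrow>\<^sub>E {..<m}. word_weight z n w * wcount y (superdesc w) q n)"
  proof (rule sum.reindex_bij_witness
      [where i = "\<lambda>w. (rank n w, restrict (w \<circ> inv (rank n w)) {1..n})"
         and j = "\<lambda>(p, a). restrict (a \<circ> p) {1..n}"])
    fix s assume s: "s \<in> ?S"
    obtain p a where pa: "s = (p, a)" by force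
    have p: "p permutes {1..n}" and a: "a \<in> compat_words (perm_desc (inv p)) m n"
      using s pa by auto
    let ?w = "restrict (a \<circ> p) {1..n}"
    have p_in: "p k \<in> {1..n}" if "k \<in> {1..n}" for k using permutes_in_image[OF p] that by blast
    have inv_in: "inv p i \<in> {1..n}" if "i \<in> {1..n}" for i
      using permutes_in_image[OF permutes_inv[OF p]] that by blast
    have w: "?w k = a (p k)" if "k \<in> {1..n}" for k using that by simp
    note prec = prec_of_compat_word[OF p a w]
    have rank: "rank n ?w = p"
      using permutes_eq_rank[OF p, of ?w] prec by metis
    have "restrict (?w \<circ> inv p) {1..n} = a"
    proof
      fix k show "restrict (?w \<circ> inv p) {1..n} k = a k"
        using compat_wordsD(2)[OF a, of k] inv_in[of k] permutes_inverses(1)[OF p, of k] by auto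
    qed
    then show "(\<lambda>w. (rank n w, restrict (w \<circ> inv (rank n w)) {1..n}))
        ((\<lambda>(p, a). restrict (a \<circ> p) {1..n}) s) = s"
      unfolding pa prod.case rank by simp
    show "(\<lambda>(p, a). restrict (a \<circ> p) {1..n}) s \<in> {1..n} \<rightarrow>\<^sub>E {..<m}"
      using compat_wordsD(1)[OF a] p_in by (auto simp: pa)
    have "word_weight z n ?w = (\<Prod>k\<in>{1..n}. letter_weight z (a (p k)))"
      unfolding word_weight_def by (rule prod.cong) auto
    also have "\<dots> = word_weight z n a"
      unfolding word_weight_def using prod.permute[OF p, of "\<lambda>k. letter_weight z (a k)"] by (simp add: o_def)
    finally have ww: "word_weight z n ?w = word_weight z n a" .
    have "superdesc ?w k = perm_desc p k" if "1 \<le> k" "k < n" for k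
      unfolding superdesc_iff_prec perm_desc_def by (rule prec) (use that in auto)
    then have "wcount y (superdesc ?w) q n = wcount y (perm_desc p) q n"
      by (rule wcount_cong)
    then show "word_weight z n ((\<lambda>(p, a). restrict (a \<circ> p) {1..n}) s)
        * wcount y (superdesc ((\<lambda>(p, a). restrict (a \<circ> p) {1..n}) s)) q n
        = (case s of (p, a) \<Rightarrow> word_weight z n a * wcount y (perm_desc p) q n)"
      using ww by (simp add: pa)
  next
    fix w assume w: "w \<in> {1..n} \<rightarrow>\<^sub>E {..<m}"
    let ?p = "rank n w"
    note p = rank_permutes[of n w]
    show "(?p, restrict (w \<circ> inv ?p) {1..n}) \<in> ?S"
      using compat_word_of_rank[OF w] p by simp
    show "(\<lambda>(p, a). restrict (a \<circ> p) {1..n}) (?p, restrict (w \<circ> inv ?p) {1..n}) = w"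
    proof
      fix k show "(\<lambda>(p, a). restrict (a \<circ> p) {1..n}) (?p, restrict (w \<circ> inv ?p) {1..n}) k = w k"
      proof (cases "k \<in> {1..n}")
        case True
        then have "?p k \<in> {1..n}" using permutes_in_image[OF p] by blast
        then show ?thesis using True permutes_inverses(2)[OF p, of k] by simp
      qed (use w in \<open>auto simp: PiE_def extensional_def\<close>)
    qed
  qed
  finally show ?thesis .
qed

section \<open>Cutting words into monotone blocks\<close>

lemma sum_words_append:
  fixes k n :: nat
  assumes "k \<le> n"
  shows "(\<Sum>w\<in>{1..n} \<rightarrow>\<^sub>E {..<m}. f w)
    = (\<Sum>u\<in>{1..k} \<rightarrow>\<^sub>E {..<m}. \<Sum>v\<in>{1..n-k} \<rightarrow>\<^sub>E {..<m}. f (\<lambda>i. if i \<le> k then u i else v (i - k)))"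
proof -
  have "(\<Sum>w\<in>{1..n} \<rightarrow>\<^sub>E {..<m}. f w)
    = (\<Sum>(u, v)\<in>({1..k} \<rightarrow>\<^sub>E {..<m}) \<times> ({1..n-k} \<rightarrow>\<^sub>E {..<m}).
         f (\<lambda>i. if i \<le> k then u i else v (i - k)))"
  proof (rule sum.reindex_bij_witness
      [where j = "\<lambda>w. (restrict w {1..k}, restrict (\<lambda>i. w (i + k)) {1..n-k})"
         and i = "\<lambda>(u, v). (\<lambda>i. if i \<le> k then u i else v (i - k))"])
    fix w assume w: "w \<in> {1..n} \<rightarrow>\<^sub>E {..<m}"
    have *: "(\<lambda>i. if i \<le> k then restrict w {1..k} i
        else restrict (\<lambda>i. w (i + k)) {1..n-k} (i - k)) = w"
    proof
      fix i show "(if i \<le> k then restrict w {1..k} i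
          else restrict (\<lambda>i. w (i + k)) {1..n-k} (i - k)) = w i"
        using w assms by (auto simp: PiE_def extensional_def)
    qed
    show "(\<lambda>(u, v). (\<lambda>i. if i \<le> k then u i else v (i - k)))
        (restrict w {1..k}, restrict (\<lambda>i. w (i + k)) {1..n-k}) = w"
      unfolding prod.case * ..
    show "(case (restrict w {1..k}, restrict (\<lambda>i. w (i + k)) {1..n-k}) of
        (u, v) \<Rightarrow> f (\<lambda>i. if i \<le> k then u i else v (i - k))) = f w"
      unfolding prod.case * ..
    show "(restrict w {1..k}, restrict (\<lambda>i. w (i + k)) {1..n-k})
        \<in> ({1..k} \<rightarrow>\<^sub>E {..<m}) \<times> ({1..n-k} \<rightarrow>\<^sub>E {..<m})"
      using w assms by (auto simp: PiE_def Pi_def)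
  next
    fix s assume "s \<in> ({1..k} \<rightarrow>\<^sub>E {..<m}) \<times> ({1..n-k} \<rightarrow>\<^sub>E {..<m})"
    then obtain u v where s: "s = (u, v)" and u: "u \<in> {1..k} \<rightarrow>\<^sub>E {..<m}"
      and v: "v \<in> {1..n-k} \<rightarrow>\<^sub>E {..<m}" by auto
    let ?w = "\<lambda>i. if i \<le> k then u i else v (i - k)"
    have "restrict ?w {1..k} = u"
      by (rule ext) (use u in \<open>auto simp: PiE_def extensional_def\<close>)
    moreover have "restrict (\<lambda>i. ?w (i + k)) {1..n-k} = v"
      by (rule ext) (use v in \<open>auto simp: PiE_def extensional_def\<close>)
    ultimately show "(\<lambda>w. (restrict w {1..k}, restrict (\<lambda>i. w (i + k)) {1..n-k}))
        ((\<lambda>(u, v). (\<lambda>i. if i \<le> k then u i else v (i - k))) s) = s"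
      unfolding s prod.case by simp
    show "(\<lambda>(u, v). (\<lambda>i. if i \<le> k then u i else v (i - k))) s \<in> {1..n} \<rightarrow>\<^sub>E {..<m}"
      unfolding s prod.case
    proof (rule PiE_I)
      fix i assume i: "i \<in> {1..n}"
      show "(if i \<le> k then u i else v (i - k)) \<in> {..<m}"
      proof (cases "i \<le> k")
        case True
        then show ?thesis using PiE_mem[OF u, of i] i by auto
      next
        case False
        then have "i - k \<in> {1..n-k}" using i by auto
        then show ?thesis using PiE_mem[OF v] False by simp
      qed
    next
      fix i assume i: "i \<notin> {1..n}"
      show "(if i \<le> k then u i else v (i - k)) = undefined"
      proof (cases "i \<le> k")
        case True
        then show ?thesis using PiE_arb[OF u, of i] i assms by auto
      next
        case False
        then have "i - k \<notin> {1..n-k}" using i by auto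
        then show ?thesis using PiE_arb[OF v] False by simp
      qed
    qed
  qed
  then show ?thesis by (simp add: sum.cartesian_product)
qed

lemma word_weight_append:
  assumes "k \<le> n"
  shows "word_weight z n (\<lambda>i. if i \<le> k then u i else v (i - k))
    = word_weight z k u * word_weight z (n - k) v"
proof -
  let ?f = "\<lambda>i. letter_weight z (if i \<le> k then u i else v (i - k))"
  have "{1..n} = {1..k} \<union> {1+k..(n-k)+k}" "{1..k} \<inter> {1+k..(n-k)+k} = {}" using assms by auto
  then have "(\<Prod>i=1..n. ?f i) = (\<Prod>i=1..k. ?f i) * (\<Prod>i=1+k..(n-k)+k. ?f i)"
    using prod.union_disjoint[of "{1..k}" "{1+k..(n-k)+k}" ?f] by auto
  also have "(\<Prod>i=1+k..(n-k)+k. ?f i) = (\<Prod>i=1..n-k. ?f (i + k))"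
    by (rule prod.shift_bounds_cl_nat_ivl)
  finally show ?thesis unfolding word_weight_def by simp
qed

text \<open>For \<open>b = False\<close> these are the weakly increasing words that repeat only even
  letters. For \<open>b = True\<close> they are weakly decreasing and repeat only odd letters, so
  reversal makes them compatible words.\<close>

lemma sum_monotone_words:
  "(\<Sum>v | v \<in> {1..l} \<rightarrow>\<^sub>E {..<m} \<and> (\<forall>i\<in>{1..<l}. superdesc v i = b). word_weight z l v)
   = wcount z (\<lambda>_. b) m l"
proof (cases b)
  case False
  have "{v. v \<in> {1..l} \<rightarrow>\<^sub>E {..<m} \<and> (\<forall>i\<in>{1..<l}. superdesc v i = b)}
    = compat_words (\<lambda>_. b) m l"
    unfolding compat_words_def superdesc_def using False
    by (intro Collect_cong conj_cong ball_cong refl) auto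
  then show ?thesis by (simp add: wcount_eq_sum_compat_words)
next
  case True
  let ?V = "{v. v \<in> {1..l} \<rightarrow>\<^sub>E {..<m} \<and> (\<forall>i\<in>{1..<l}. superdesc v i = b)}"
  let ?r = "\<lambda>v. restrict (\<lambda>i. v (Suc l - i)) {1..l}"
  have inv: "?r (?r v) = v" if "v \<in> {1..l} \<rightarrow>\<^sub>E {..<m}" for v :: "nat \<Rightarrow> nat"
    by (rule ext) (use that in \<open>auto simp: PiE_def extensional_def\<close>)
  have rev_in: "?r v \<in> {1..l} \<rightarrow>\<^sub>E {..<m}" if v: "v \<in> {1..l} \<rightarrow>\<^sub>E {..<m}" for v :: "nat \<Rightarrow> nat"
  proof (rule restrict_PiE_iff[THEN iffD2], rule ballI)
    fix k assume "k \<in> {1..l}"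
    then have "Suc l - k \<in> {1..l}" by auto
    then show "v (Suc l - k) \<in> {..<m}" using v by blast
  qed
  have sub: "v \<in> {1..l} \<rightarrow>\<^sub>E {..<m}" if "v \<in> compat_words (\<lambda>_. b) m l" for v
    using that by (simp add: compat_words_def)
  have "(\<Sum>v\<in>?V. word_weight z l v) = (\<Sum>a\<in>compat_words (\<lambda>_. b) m l. word_weight z l a)"
  proof (rule sum.reindex_bij_witness[where i = ?r and j = ?r])
    fix v assume v: "v \<in> ?V"
    then show "?r (?r v) = v" using inv by blast
    show "?r v \<in> compat_words (\<lambda>_. b) m l"
    proof (rule compat_wordsI)
      fix i assume i: "1 \<le> i" "i < l"
      define j where "j = l - i"
      have j: "j \<in> {1..<l}" "Suc l - i = Suc j" "Suc l - Suc i = j" using i by (auto simp: j_def)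
      have "superdesc v j" using v j True by auto
      then have *: "v (Suc j) < v j \<or> v j = v (Suc j) \<and> odd (v j)" by (simp add: superdesc_def)
      then show "?r v i \<le> ?r v (Suc i)" using i j by auto
      assume "?r v i = ?r v (Suc i)"
      then show "b = odd (?r v i)" using * i j True by auto
    next
      show "?r v k < m" if "k \<in> {1..l}" for k
        using PiE_mem[OF rev_in that] v by blast
    qed auto
    show "word_weight z l (?r v) = word_weight z l v"
      unfolding word_weight_def
      by (rule prod.reindex_bij_witness[where i = "\<lambda>i. Suc l - i" and j = "\<lambda>i. Suc l - i"]) auto
  next
    fix a assume a: "a \<in> compat_words (\<lambda>_. b) m l"
    then show "?r (?r a) = a" using inv sub by blast
    have "superdesc (?r a) i = b" if i: "i \<in> {1..<l}" for i
    proof -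
      define j where "j = l - i"
      have j: "1 \<le> j" "j < l" "Suc l - i = Suc j" "Suc l - Suc i = j" using i by (auto simp: j_def)
      show ?thesis using compat_wordsD(3,4)[OF a j(1,2)] i j True by (auto simp: superdesc_def)
    qed
    moreover have "?r a \<in> {1..l} \<rightarrow>\<^sub>E {..<m}" by (rule rev_in[OF sub[OF a]])
    ultimately show "?r a \<in> ?V" by simp
  qed
  then show ?thesis by (simp add: wcount_eq_sum_compat_words)
qed

section \<open>Recursion over the letters of the first alphabet\<close>

definition pair_count :: "'a \<Rightarrow> 'a \<Rightarrow> nat \<Rightarrow> nat \<Rightarrow> nat \<Rightarrow> 'a::comm_ring_1" where
  "pair_count y z q m n =
     (\<Sum>p | p permutes {1..n}. wcount y (perm_desc p) q n * wcount z (perm_desc (inv p)) m n)"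

text \<open>After standardization, \<open>w\<close> is cut before the block belonging to the largest
  letter \<open>q\<close>. The block is a monotone word of type \<open>odd q\<close>, and as the cut
  at position \<open>k\<close> carries no condition, prefix and block range independently.\<close>

lemma pair_count_Suc:
  "pair_count y z (Suc q) m n = (\<Sum>k\<le>n. pair_count y z q m k
     * (letter_weight y q ^ (n - k) * wcount z (\<lambda>_. odd q) m (n - k)))"
proof -
  let ?W = "\<lambda>n. {1..n} \<rightarrow>\<^sub>E {..<m}"
  let ?T = "\<lambda>w k. if \<forall>l\<in>{k<..<n}. superdesc w l = odd q
      then letter_weight y q ^ (n - k) * wcount y (superdesc w) q k else 0"
  have fin: "finite (?W n)" for n :: nat by (simp add: finite_PiE)
  have "pair_count y z (Suc q) m n = (\<Sum>w\<in>?W n. \<Sum>k\<le>n. word_weight z n w * ?T w k)"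
    unfolding pair_count_def standardization unfolding wcount_last_block by (simp only: sum_distrib_left)
  also have "\<dots> = (\<Sum>k\<le>n. \<Sum>w\<in>?W n. word_weight z n w * ?T w k)" by (rule sum.swap)
  also have "\<dots> = (\<Sum>k\<le>n. pair_count y z q m k
     * (letter_weight y q ^ (n - k) * wcount z (\<lambda>_. odd q) m (n - k)))"
  proof (rule sum.cong[OF refl])
    fix k assume "k \<in> {..n}"
    then have k: "k \<le> n" by simp
    have "(\<Sum>w\<in>?W n. word_weight z n w * ?T w k)
      = (\<Sum>u\<in>?W k. \<Sum>v\<in>?W (n - k). (word_weight z k u * wcount y (superdesc u) q k)
          * (letter_weight y q ^ (n - k) *
            (if \<forall>i\<in>{1..<n-k}. superdesc v i = odd q then word_weight z (n - k) v else 0)))"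
      unfolding sum_words_append[OF k]
    proof (intro sum.cong refl)
      fix u v :: "nat \<Rightarrow> nat"
      let ?w = "\<lambda>i. if i \<le> k then u i else v (i - k)"
      have "superdesc ?w (i + k) = superdesc v i" if "i \<ge> 1" for i
        using that by (auto simp: superdesc_def Suc_diff_le)
      then have "(\<forall>l\<in>{k<..<n}. superdesc ?w l = odd q) \<longleftrightarrow> (\<forall>i\<in>{1..<n-k}. superdesc v i = odd q)"
      proof -
        assume *: "\<And>i. 1 \<le> i \<Longrightarrow> superdesc ?w (i + k) = superdesc v i"
        have "{k<..<n} = (\<lambda>i. i + k) ` {1..<n-k}"
        proof (intro equalityI subsetI)
          fix l assume "l \<in> {k<..<n}"
          then have "l = (l - k) + k" "l - k \<in> {1..<n-k}" by auto
          then show "l \<in> (\<lambda>i. i + k) ` {1..<n-k}" by blast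
        qed auto
        then show ?thesis by (simp only: ball_simps) (intro ball_cong refl, simp add: *)
      qed
      moreover have "wcount y (superdesc ?w) q k = wcount y (superdesc u) q k"
        by (rule wcount_cong) (auto simp: superdesc_def)
      ultimately show "word_weight z n ?w * ?T ?w k
        = (word_weight z k u * wcount y (superdesc u) q k) * (letter_weight y q ^ (n - k) *
            (if \<forall>i\<in>{1..<n-k}. superdesc v i = odd q then word_weight z (n - k) v else 0))"
        unfolding word_weight_append[OF k] by simp
    qed
    also have "\<dots> = (\<Sum>u\<in>?W k. word_weight z k u * wcount y (superdesc u) q k)
       * (letter_weight y q ^ (n - k) *
          (\<Sum>v\<in>?W (n - k). if \<forall>i\<in>{1..<n-k}. superdesc v i = odd q then word_weight z (n - k) v else 0))"
      by (simp only: sum_distrib_left sum_distrib_right) (rule sum.swap)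
    also have "(\<Sum>v\<in>?W (n - k). if \<forall>i\<in>{1..<n-k}. superdesc v i = odd q then word_weight z (n - k) v else 0)
      = wcount z (\<lambda>_. odd q) m (n - k)"
      unfolding sum_monotone_words[symmetric] using fin[of "n - k"]
      by (subst sum.inter_filter[symmetric]) auto
    finally show "(\<Sum>w\<in>?W n. word_weight z n w * ?T w k) = pair_count y z q m k
     * (letter_weight y q ^ (n - k) * wcount z (\<lambda>_. odd q) m (n - k))"
      unfolding pair_count_def standardization .
  qed
  finally show ?thesis .
qed

section \<open>Product formula over pairs of letters\<close>

definition monotone_fps :: "'a \<Rightarrow> 'a \<Rightarrow> bool \<Rightarrow> nat \<Rightarrow> 'a::comm_ring_1 fps" where
  "monotone_fps c z b m = Abs_fps (\<lambda>l. c ^ l * wcount z (\<lambda>_. b) m l)"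

lemma monotone_fps_0: "monotone_fps c z b 0 = 1"
  by (rule fps_ext) (auto simp: monotone_fps_def)

text \<open>The second summand removes one copy of the largest letter. A repeatable letter of weight
  \<open>w\<close> thus gives a factor \<open>1 / (1 - c w x)\<close>, any other a factor
  \<open>1 + c w x\<close>.\<close>

lemma monotone_fps_Suc:
  "monotone_fps c z b (Suc m) = monotone_fps c z b m
     + fps_const (c * letter_weight z m) * fps_X * monotone_fps c z b (if b = odd m then Suc m else m)"
proof (rule fps_ext)
  fix n
  show "monotone_fps c z b (Suc m) $ n = (monotone_fps c z b m
     + fps_const (c * letter_weight z m) * fps_X * monotone_fps c z b (if b = odd m then Suc m else m)) $ n"
    by (cases n) (auto simp: monotone_fps_def mult.assoc algebra_simps)
qed

text \<open>Of the \<open>2 * i + 1\<close> letters, \<open>i + 1\<close> are even with weight 1 and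
  \<open>i\<close> are odd with weight \<open>z\<close>. Letters of the type of the block contribute
  the denominators, which are cleared here.\<close>

lemma monotone_fps_odd_length:
  "(1 - fps_const c * fps_X) ^ Suc i * monotone_fps c z False (Suc (2 * i))
     = (1 + fps_const (c * z) * fps_X) ^ i" (is ?A)
  "(1 - fps_const (c * z) * fps_X) ^ i * monotone_fps c z True (Suc (2 * i))
     = (1 + fps_const c * fps_X) ^ Suc i" (is ?B)
proof -
  have even_step: "(1 - fps_const c * fps_X) * monotone_fps c z False (Suc (2 * i)) = monotone_fps c z False (2 * i)"
    "monotone_fps c z True (Suc (2 * i)) = (1 + fps_const c * fps_X) * monotone_fps c z True (2 * i)" for i
    using monotone_fps_Suc[of c z False "2 * i"] monotone_fps_Suc[of c z True "2 * i"]
    by (simp_all add: letter_weight_def algebra_simps)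
  have odd_step: "monotone_fps c z False (2 * Suc i) = (1 + fps_const (c * z) * fps_X) * monotone_fps c z False (Suc (2 * i))"
    "(1 - fps_const (c * z) * fps_X) * monotone_fps c z True (2 * Suc i) = monotone_fps c z True (Suc (2 * i))" for i
    using monotone_fps_Suc[of c z False "Suc (2 * i)"] monotone_fps_Suc[of c z True "Suc (2 * i)"]
    by (simp_all add: letter_weight_def algebra_simps)
  show ?A
  proof (induction i)
    case 0
    then show ?case using even_step(1)[of 0] by (simp add: monotone_fps_0)
  next
    case (Suc i)
    have "(1 - fps_const c * fps_X) ^ Suc (Suc i) * monotone_fps c z False (Suc (2 * Suc i))
      = (1 - fps_const c * fps_X) ^ Suc i * ((1 - fps_const c * fps_X) * monotone_fps c z False (Suc (2 * Suc i)))"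
      by (simp only: power_Suc mult_ac)
    also have "\<dots> = (1 + fps_const (c * z) * fps_X) *
        ((1 - fps_const c * fps_X) ^ Suc i * monotone_fps c z False (Suc (2 * i)))"
      unfolding even_step odd_step by (simp only: mult_ac)
    finally show ?case unfolding Suc by simp
  qed
  show ?B
  proof (induction i)
    case 0
    then show ?case using even_step(2)[of 0] by (simp add: monotone_fps_0)
  next
    case (Suc i)
    have "(1 - fps_const (c * z) * fps_X) ^ Suc i * monotone_fps c z True (Suc (2 * Suc i))
      = (1 + fps_const c * fps_X) * ((1 - fps_const (c * z) * fps_X) ^ i *
         ((1 - fps_const (c * z) * fps_X) * monotone_fps c z True (2 * Suc i)))"
      unfolding even_step by (simp only: power_Suc mult_ac)
    then show ?case unfolding odd_step Suc by simp
  qed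
qed

definition pair_count_fps :: "'a \<Rightarrow> 'a \<Rightarrow> nat \<Rightarrow> nat \<Rightarrow> 'a::comm_ring_1 fps" where
  "pair_count_fps y z q m = Abs_fps (pair_count y z q m)"

lemma pair_count_fps_0: "pair_count_fps y z 0 m = 1"
  by (rule fps_ext) (auto simp: pair_count_fps_def pair_count_def)

lemma pair_count_fps_Suc:
  "pair_count_fps y z (Suc q) m = pair_count_fps y z q m * monotone_fps (letter_weight y q) z (odd q) m"
  by (rule fps_ext)
    (simp add: pair_count_fps_def monotone_fps_def fps_mult_nth pair_count_Suc atLeast0AtMost)

text \<open>Each induction step adds an odd letter of weight \<open>y\<close> and an even letter of
  weight 1 to the first alphabet, and each brings its factor from
  \<open>monotone_fps_odd_length\<close>.\<close>

lemma pair_count_fps_odd: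
  "(1 - fps_const (y * z) * fps_X) ^ (i * j) * (1 - fps_X) ^ (Suc i * Suc j)
      * pair_count_fps y z (Suc (2 * i)) (Suc (2 * j))
    = (1 + fps_const y * fps_X) ^ (i * Suc j) * (1 + fps_const z * fps_X) ^ (Suc i * j)"
proof (induction i)
  case 0
  show ?case using monotone_fps_odd_length(1)[of 1 j z]
    by (simp add: pair_count_fps_Suc pair_count_fps_0 letter_weight_def)
next
  case (Suc i)
  let ?H = "pair_count_fps y z (Suc (2 * i)) (Suc (2 * j))"
  let ?Mt = "monotone_fps y z True (Suc (2 * j))"
  let ?Mf = "monotone_fps 1 z False (Suc (2 * j))"
  have H: "pair_count_fps y z (Suc (2 * Suc i)) (Suc (2 * j)) = ?H * ?Mt * ?Mf"
    by (simp add: pair_count_fps_Suc letter_weight_def)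
  have "(1 - fps_const (y * z) * fps_X) ^ (Suc i * j) * (1 - fps_X) ^ (Suc (Suc i) * Suc j)
      * pair_count_fps y z (Suc (2 * Suc i)) (Suc (2 * j))
    = ((1 - fps_const (y * z) * fps_X) ^ (i * j) * (1 - fps_X) ^ (Suc i * Suc j) * ?H)
      * ((1 - fps_const (y * z) * fps_X) ^ j * ?Mt) * ((1 - fps_const 1 * fps_X) ^ Suc j * ?Mf)"
    unfolding H mult_Suc[of i] mult_Suc[of "Suc i"] power_add fps_const_1_eq_1 mult_1_left by (simp only: mult_ac)
  also have "\<dots> = (1 + fps_const y * fps_X) ^ (i * Suc j) * (1 + fps_const z * fps_X) ^ (Suc i * j)
     * (1 + fps_const y * fps_X) ^ Suc j * (1 + fps_const (1 * z) * fps_X) ^ j"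
    unfolding Suc monotone_fps_odd_length ..
  also have "\<dots> = (1 + fps_const y * fps_X) ^ (Suc i * Suc j) * (1 + fps_const z * fps_X) ^ (Suc (Suc i) * j)"
    unfolding mult_Suc[of i] mult_Suc[of "Suc i"] power_add mult_1_left by (simp only: mult_ac)
  finally show ?case .
qed

section \<open>Descents and left peaks\<close>

lemma card_filter_atLeastLessThan_Suc:
  "card {i \<in> {1..<Suc n}. P i} = card {i \<in> {1..<n}. P i} + (if 1 \<le> n \<and> P n then 1 else 0)"
proof (cases "1 \<le> n \<and> P n")
  case True
  then have "{i \<in> {1..<Suc n}. P i} = insert n {i \<in> {1..<n}. P i}" by auto
  then show ?thesis using True by simp
next
  case False
  then have "{i \<in> {1..<Suc n}. P i} = {i \<in> {1..<n}. P i}" by (auto simp: less_Suc_eq)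
  then show ?thesis using False by simp
qed

text \<open>
  \<open>E n\<close> and \<open>F n\<close> are the generating functions of the counts over the alphabets with largest letter
  unprimed and primed, respectively. The first step counts as an ascent, which is why left peaks
  appear rather than peaks.
\<close>

lemma two_state_recurrence:
  fixes y s Y S :: "'a::idom" and E F :: "nat \<Rightarrow> 'a"
  assumes D0: "\<not> D 0"
    and E0: "(1 - s) * E 0 = 1"
    and E: "\<And>n. E (Suc n) = F (Suc n) + (if D n then F n else E n)"
    and F: "\<And>n. F (Suc n) = s * E (Suc n) + y * (if D n then F n else s * E n)"
    and S: "S * (1 + y * s) = y + s"
    and Y: "Y * ((y + s) * (1 + y * s)) = (1 + y)\<^sup>2 * s"
    and nz: "1 + y * s \<noteq> 0"
  shows "(1 - s) ^ (n + 1) * E n = (1 + y * s) ^ n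
    * Y ^ card {i \<in> {1..<n}. D i \<and> \<not> D (i - 1)} * S ^ card {i \<in> {1..<n}. D i}"
proof (induction n)
  case 0
  then show ?case using E0 by simp
next
  case (Suc n)
  have nz1: "1 - s \<noteq> 0" using E0 by auto
  \<comment> \<open>Solving the two linear equations for \<open>E (Suc n)\<close> and
    \<open>F (Suc n)\<close> leaves multiples of \<open>F n\<close> at a descent and of
    \<open>E n\<close> at an ascent.\<close>
  have desc: "(1 - s) * E (Suc n) = (1 + y) * F n" "(1 - s) * F (Suc n) = (y + s) * F n" if "D n" for n
    using E[of n, unfolded if_P[OF that]] F[of n, unfolded if_P[OF that]] by algebra+
  have asc: "(1 - s) * E (Suc n) = (1 + y * s) * E n" "(1 - s) * F (Suc n) = s * (1 + y) * E n"
    if "\<not> D n" for n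
    using E[of n, unfolded if_not_P[OF that]] F[of n, unfolded if_not_P[OF that]] by algebra+
  \<comment> \<open>The ratio of \<open>F\<close> to \<open>E\<close> depends only on the type of
    the preceding step, so \<open>F\<close> can be eliminated.\<close>
  have after_desc: "(1 + y) * F (Suc k) = (y + s) * E (Suc k)" if "D k" for k
  proof -
    have "(1 - s) * ((1 + y) * F (Suc k)) = (1 + y) * ((1 - s) * F (Suc k))" by (simp add: mult_ac)
    also have "\<dots> = (y + s) * ((1 - s) * E (Suc k))" unfolding desc[OF that] by (simp add: mult_ac)
    also have "\<dots> = (1 - s) * ((y + s) * E (Suc k))" by (simp add: mult_ac)
    finally show ?thesis using nz1 by simp
  qed
  have after_asc: "(1 + y * s) * F (Suc k) = s * (1 + y) * E (Suc k)" if "\<not> D k" for k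
  proof -
    have "(1 - s) * ((1 + y * s) * F (Suc k)) = (1 + y * s) * ((1 - s) * F (Suc k))" by (simp add: mult_ac)
    also have "\<dots> = s * (1 + y) * ((1 - s) * E (Suc k))" unfolding asc[OF that] by (simp add: mult_ac)
    also have "\<dots> = (1 - s) * (s * (1 + y) * E (Suc k))" by (simp add: mult_ac)
    finally show ?thesis using nz1 by simp
  qed
  let ?f = "(if D n \<and> \<not> D (n - 1) then Y else 1) * (if D n then S else 1)"
  have "(1 - s) * E (Suc n) = (1 + y * s) * ?f * E n"
  proof (cases "D n")
    case False
    then show ?thesis using asc by simp
  next
    case True
    then obtain k where k: "n = Suc k" using D0 by (cases n) auto
    show ?thesis
    proof (cases "D k")
      case prev: True
      have "(1 - s) * E (Suc n) = (S * (1 + y * s)) * E n"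
        unfolding desc[OF True] S using after_desc[OF prev] k by simp
      then show ?thesis using True prev k by (simp add: mult_ac)
    next
      case prev: False
      have "(1 + y * s) * ((1 - s) * E (Suc n)) = (1 + y) * ((1 + y * s) * F n)"
        unfolding desc[OF True] by (simp add: mult_ac)
      also have "\<dots> = ((1 + y)\<^sup>2 * s) * E n"
        using after_asc[OF prev] k by (simp add: power2_eq_square mult_ac)
      also have "\<dots> = (1 + y * s) * (Y * (S * (1 + y * s)) * E n)"
        unfolding Y[symmetric] S by (simp only: mult_ac)
      finally have "(1 - s) * E (Suc n) = Y * (S * (1 + y * s)) * E n" using nz by simp
      then show ?thesis using True prev k by (simp add: mult_ac)
    qed
  qed
  then have "(1 - s) ^ (Suc n + 1) * E (Suc n) = (1 + y * s) * ?f * ((1 - s) ^ (n + 1) * E n)"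
    by (simp add: mult_ac)
  also have "\<dots> = (1 + y * s) ^ Suc n
    * Y ^ card {i \<in> {1..<Suc n}. D i \<and> \<not> D (i - 1)} * S ^ card {i \<in> {1..<Suc n}. D i}"
  proof -
    have "D n \<Longrightarrow> 1 \<le> n" using D0 by (cases n) auto
    then show ?thesis unfolding Suc card_filter_atLeastLessThan_Suc by (auto simp: mult_ac)
  qed
  finally show ?case .
qed

section \<open>Generating functions in the size of the alphabet\<close>

definition wcount_odd_fps :: "'a \<Rightarrow> (nat \<Rightarrow> bool) \<Rightarrow> nat \<Rightarrow> 'a::comm_ring_1 fps" where
  "wcount_odd_fps y D n = Abs_fps (\<lambda>i. wcount y D (Suc (2 * i)) n)"

definition wcount_even_fps :: "'a \<Rightarrow> (nat \<Rightarrow> bool) \<Rightarrow> nat \<Rightarrow> 'a::comm_ring_1 fps" where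
  "wcount_even_fps y D n = Abs_fps (\<lambda>i. wcount y D (2 * i) n)"

lemma wcount_odd_fps_0: "(1 - fps_X) * wcount_odd_fps y D 0 = 1"
proof (rule fps_ext)
  fix n show "((1 - fps_X) * wcount_odd_fps y D 0) $ n = 1 $ n"
    by (cases n) (auto simp: wcount_odd_fps_def left_diff_distrib)
qed

lemma wcount_odd_fps_Suc:
  "wcount_odd_fps y D (Suc n) = wcount_even_fps y D (Suc n)
     + (if D n then wcount_even_fps y D n else wcount_odd_fps y D n)"
  by (rule fps_ext) (simp add: wcount_odd_fps_def wcount_even_fps_def letter_weight_def)

text \<open>Removing the primed letter \<open>2 * i - 1\<close> leaves
  \<open>2 * (i - 1) + 1\<close> letters, hence the factor \<open>fps_X\<close> before the odd
  series. At descents the primed letter may recur, which keeps the even series there.\<close>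

lemma wcount_even_fps_Suc:
  assumes "\<not> D 0"
  shows "wcount_even_fps y D (Suc n) = fps_X * wcount_odd_fps y D (Suc n)
     + fps_const y * (if D n then wcount_even_fps y D n else fps_X * wcount_odd_fps y D n)"
proof (rule fps_ext)
  fix i
  show "wcount_even_fps y D (Suc n) $ i = (fps_X * wcount_odd_fps y D (Suc n)
     + fps_const y * (if D n then wcount_even_fps y D n else fps_X * wcount_odd_fps y D n)) $ i"
  proof (cases i)
    case 0
    \<comment> \<open>Over the empty alphabet the count is 1 at length 0 and 0 at positive length;
      the assumption on \<open>D 0\<close> keeps the former out of the descent branch.\<close>
    have "D n \<Longrightarrow> n \<noteq> 0" using assms by (cases n) auto
    then show ?thesis using 0 by (auto simp: wcount_odd_fps_def wcount_even_fps_def)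
  next
    case (Suc j)
    then show ?thesis
      by (auto simp: wcount_odd_fps_def wcount_even_fps_def letter_weight_def)
  qed
qed

text \<open>A left peak is a descent not preceded by a descent. Making \<open>D\<close> false at 0
  puts a fictitious ascent before position 1, so a descent at 1 counts.\<close>

lemma lpk_des_eq_card:
  assumes p: "p permutes {1..n}" and D_def: "D = (\<lambda>k. k \<noteq> 0 \<and> perm_desc p k)"
  shows "des n p = card {i \<in> {1..<n}. D i}"
    and "lpk n p = card {i \<in> {1..<n}. D i \<and> \<not> D (i - 1)}"
proof -
  have "{i. is_descent n p i} = {i \<in> {1..<n}. D i}"
    by (auto simp: is_descent_def D_def perm_desc_def)
  then show "des n p = card {i \<in> {1..<n}. D i}" by (simp add: des_def)
  have "is_left_peak n p i \<longleftrightarrow> i \<in> {1..<n} \<and> D i \<and> \<not> D (i - 1)" for i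
  proof (cases i)
    case 0
    then show ?thesis by (simp add: is_left_peak_def)
  next
    case (Suc k)
    have "p k \<noteq> p (Suc k)" using permutes_inj[OF p] by (simp add: inj_eq)
    then show ?thesis using Suc
      by (cases k) (auto simp: is_left_peak_def is_peak_def D_def perm_desc_def numeral_2_eq_2)
  qed
  then have "{i. is_left_peak n p i} = {i \<in> {1..<n}. D i \<and> \<not> D (i - 1)}" by auto
  then show "lpk n p = card {i \<in> {1..<n}. D i \<and> \<not> D (i - 1)}" by (simp add: lpk_def)
qed

lemma wcount_perm_desc_nonzero:
  "wcount y (\<lambda>k. k \<noteq> 0 \<and> perm_desc p k) m n = wcount y (perm_desc p) m n"
  by (rule wcount_cong) auto

section \<open>Comparison of coefficients\<close>

lemma fps3_divide_eqI:
  fixes f g h :: "'a::field fps fps fps"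
  assumes "g $ 0 $ 0 $ 0 \<noteq> 0" "h * g = f"
  shows "f / g = h"
  unfolding fps3_divide_unit[OF assms(1)] assms(2)[symmetric]
  by (simp add: mult.assoc fps3_mult_inverse[OF assms(1)])

lemma fps3_divide_mult_cancel:
  fixes f g :: "'a::field fps fps fps"
  assumes "g $ 0 $ 0 $ 0 \<noteq> 0"
  shows "f / g * g = f"
  unfolding fps3_divide_unit[OF assms]
  by (simp add: mult.assoc mult.commute[of _ g] fps3_mult_inverse[OF assms])

lemma fps3_mult_nth_0: "(f * g) $ 0 $ 0 $ 0 = f $ 0 $ 0 $ 0 * g $ 0 $ 0 $ 0"
  for f g :: "'a::field fps fps fps"
  by (simp add: fps_mult_nth)

lemma fps3_power_nth_0: "(f ^ n) $ 0 $ 0 $ 0 = (f $ 0 $ 0 $ 0) ^ n"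
  for f :: "'a::field fps fps fps"
  by (induction n) (simp_all add: fps3_mult_nth_0)

text \<open>On both sides of the identity each monomial comes from at most one member of the family,
  the one with index \<open>g a b c\<close>.\<close>

lemma fps3_summable_single:
  assumes "\<And>k a b c. f k $ a $ b $ c = (if k = g a b c then v a b c else 0)"
  shows "fps3_summable f A"
    and "fps3_sum f A $ a $ b $ c = (if g a b c \<in> A then v a b c else 0)"
proof -
  have sub: "{k \<in> A. f k $ a $ b $ c \<noteq> 0} \<subseteq> {g a b c}" for a b c by (auto simp: assms)
  show "fps3_summable f A"
    unfolding fps3_summable_def by (intro allI finite_subset[OF sub]) simp
  have "{k \<in> A. f k $ a $ b $ c \<noteq> 0} = (if g a b c \<in> A \<and> v a b c \<noteq> 0 then {g a b c} else {})"
    by (auto simp: assms)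
  then show "fps3_sum f A $ a $ b $ c = (if g a b c \<in> A then v a b c else 0)"
    by (simp add: fps3_sum_def assms)
qed

text \<open>The ring homomorphism \<open>h\<close> embeds series in one variable into the ambient
  ring, so that one statement serves \<open>s\<close> with \<open>p\<close> as well as
  \<open>t\<close> with \<open>inv p\<close>.\<close>

lemma lpk_des_series:
  fixes h :: "'b::comm_ring_1 fps \<Rightarrow> 'a::field fps fps fps" and y :: 'b
  assumes p: "p permutes {1..n}"
    and h_add: "\<And>f g. h (f + g) = h f + h g" and h_mult: "\<And>f g. h (f * g) = h f * h g"
    and h_1: "h 1 = 1"
  defines "v \<equiv> h (fps_const y)" and "s \<equiv> h fps_X"
  assumes u1: "(1 + v * s) $ 0 $ 0 $ 0 \<noteq> 0" and u2: "(v + s) $ 0 $ 0 $ 0 \<noteq> 0"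
  shows "(1 - s) ^ (n + 1) * h (wcount_odd_fps y (perm_desc p) n)
    = (1 + v * s) ^ n * ((1 + v)\<^sup>2 * s / ((v + s) * (1 + v * s))) ^ lpk n p
        * ((v + s) / (1 + v * s)) ^ des n p"
proof -
  define D where "D = (\<lambda>k. k \<noteq> 0 \<and> perm_desc p k)"
  have D0: "\<not> D 0" by (simp add: D_def)
  let ?E = "wcount_odd_fps y D" and ?F = "wcount_even_fps y D"
  have "(1 - s) ^ (n + 1) * h (?E n) = (1 + v * s) ^ n
      * ((1 + v)\<^sup>2 * s / ((v + s) * (1 + v * s))) ^ card {i \<in> {1..<n}. D i \<and> \<not> D (i - 1)}
      * ((v + s) / (1 + v * s)) ^ card {i \<in> {1..<n}. D i}"
  proof (rule two_state_recurrence[where D = D and E = "\<lambda>n. h (?E n)" and F = "\<lambda>n. h (?F n)"])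
    show "\<not> D 0" by (rule D0)
  next
    have "h (1 - fps_X) + h fps_X = 1" unfolding h_add[symmetric] by (simp add: h_1)
    then have "1 - s = h (1 - fps_X)" by (simp add: s_def algebra_simps)
    then show "(1 - s) * h (?E 0) = 1"
      by (simp add: h_1 wcount_odd_fps_0 flip: h_mult)
  next
    fix n
    show "h (?E (Suc n)) = h (?F (Suc n)) + (if D n then h (?F n) else h (?E n))"
      unfolding wcount_odd_fps_Suc[of y D n] h_add by simp
    show "h (?F (Suc n)) = s * h (?E (Suc n)) + v * (if D n then h (?F n) else s * h (?E n))"
      unfolding wcount_even_fps_Suc[of D y n, OF D0] h_add h_mult by (simp add: s_def v_def h_mult)
  next
    show "(v + s) / (1 + v * s) * (1 + v * s) = v + s"
      by (rule fps3_divide_mult_cancel[OF u1])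
    show "(1 + v)\<^sup>2 * s / ((v + s) * (1 + v * s)) * ((v + s) * (1 + v * s)) = (1 + v)\<^sup>2 * s"
      using u1 u2 by (intro fps3_divide_mult_cancel) (simp only: fps3_mult_nth_0 mult_eq_0_iff simp_thms)
    show "1 + v * s \<noteq> 0" using u1 by (metis fps_zero_nth)
  qed
  moreover have "?E n = wcount_odd_fps y (perm_desc p) n"
    unfolding wcount_odd_fps_def D_def wcount_perm_desc_nonzero ..
  ultimately show ?thesis unfolding lpk_des_eq_card[OF p D_def] by (simp only:)
qed

lemma pair_count_fps_const:
  "pair_count (fps_const y) (fps_const z) q m n = fps_const (pair_count y z q m n)"
proof -
  have "(\<Sum>p\<in>P. fps_const (f p)) = fps_const (\<Sum>p\<in>P. f p)"
    for P and f :: "(nat \<Rightarrow> nat) \<Rightarrow> 'a"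
    by (induction P rule: infinite_finite_induct) auto
  then show ?thesis by (simp add: pair_count_def wcount_fps_const)
qed

definition coeff_y :: ratfun2 where "coeff_y = to_fract [:[:0, 1:]:]"
definition coeff_z :: ratfun2 where "coeff_z = to_fract [:0, 1:]"

lemma var_yz: "var_y = fps_const (fps_const (fps_const coeff_y))"
  "var_z = fps_const (fps_const (fps_const coeff_z))"
  by (simp_all add: var_y_def var_z_def coeff_y_def coeff_z_def)

text \<open>By \<open>lpk_des_series\<close>, the powers of the substituted arguments for each
  \<open>p\<close> are the series of counts for \<open>p\<close> in \<open>s\<close> and for
  \<open>inv p\<close> in \<open>t\<close>. Products of their coefficients, summed over
  \<open>p\<close>, give \<open>pair_count\<close>.\<close>

lemma lhs_term_nth:
  "((1 + var_y * var_s) ^ n * (1 + var_z * var_t) ^ n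
        * lpk_des_poly n
            ((1 + var_y)\<^sup>2 * var_s / ((var_y + var_s) * (1 + var_y * var_s)))
            ((1 + var_z)\<^sup>2 * var_t / ((var_z + var_t) * (1 + var_z * var_t)))
            ((var_y + var_s) / (1 + var_y * var_s))
            ((var_z + var_t) / (1 + var_z * var_t))
        / ((1 - var_s) ^ (n + 1) * (1 - var_t) ^ (n + 1))
        * var_x ^ n) $ a $ b $ c
   = (if n = a then pair_count coeff_y coeff_z (Suc (2 * c)) (Suc (2 * b)) a else 0)"
proof -
  let ?Y = "(1 + var_y)\<^sup>2 * var_s / ((var_y + var_s) * (1 + var_y * var_s))"
  let ?Z = "(1 + var_z)\<^sup>2 * var_t / ((var_z + var_t) * (1 + var_z * var_t))"
  let ?S = "(var_y + var_s) / (1 + var_y * var_s)"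
  let ?T = "(var_z + var_t) / (1 + var_z * var_t)"
  let ?P = "{p. p permutes {1..n}}"
  define Es where "Es = (\<lambda>p. wcount_odd_fps coeff_y (perm_desc p) n)"
  define Et where "Et = (\<lambda>p. wcount_odd_fps (fps_const coeff_z) (perm_desc (inv p)) n)"
  define H where "H = (\<Sum>p\<in>?P. fps_const (Es p) * Et p)"
  have const_sum: "fps_const (\<Sum>p\<in>P. f p) = (\<Sum>p\<in>P. fps_const (f p))"
    for P and f :: "(nat \<Rightarrow> nat) \<Rightarrow> ratfun2 fps fps"
    by (induction P rule: infinite_finite_induct) (auto simp flip: fps_const_add)
  have s: "(1 - var_s) ^ (n + 1) * fps_const (fps_const (Es p))
      = (1 + var_y * var_s) ^ n * ?Y ^ lpk n p * ?S ^ des n p" if "p \<in> ?P" for p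
    using lpk_des_series[of p n "\<lambda>f. fps_const (fps_const f)" coeff_y] that
      denominators_units(3,5) by (simp add: var_yz var_s_def Es_def)
  have t: "(1 - var_t) ^ (n + 1) * fps_const (Et p)
      = (1 + var_z * var_t) ^ n * ?Z ^ ilpk n p * ?T ^ ides n p" if "p \<in> ?P" for p
    using lpk_des_series[of "inv p" n fps_const "fps_const coeff_z"] permutes_inv[of p "{1..n}"] that
      denominators_units(4,6) by (simp add: var_yz var_t_def Et_def ilpk_def ides_def)
  have "fps_const H * ((1 - var_s) ^ (n + 1) * (1 - var_t) ^ (n + 1))
    = (\<Sum>p\<in>?P. ((1 - var_s) ^ (n + 1) * fps_const (fps_const (Es p)))
          * ((1 - var_t) ^ (n + 1) * fps_const (Et p)))"
    unfolding H_def const_sum sum_distrib_right fps_const_mult[symmetric] by (simp only: mult_ac)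
  also have "\<dots> = (\<Sum>p\<in>?P. ((1 + var_y * var_s) ^ n * ?Y ^ lpk n p * ?S ^ des n p)
          * ((1 + var_z * var_t) ^ n * ?Z ^ ilpk n p * ?T ^ ides n p))"
    by (rule sum.cong[OF refl]) (simp only: s t)
  also have "\<dots> = (1 + var_y * var_s) ^ n * (1 + var_z * var_t) ^ n * lpk_des_poly n ?Y ?Z ?S ?T"
    unfolding lpk_des_poly_def sum_distrib_left by (simp only: mult_ac)
  finally have H: "(1 + var_y * var_s) ^ n * (1 + var_z * var_t) ^ n * lpk_des_poly n ?Y ?Z ?S ?T
      / ((1 - var_s) ^ (n + 1) * (1 - var_t) ^ (n + 1)) = fps_const H"
    by (intro fps3_divide_eqI)
      (simp_all only: fps3_mult_nth_0 fps3_power_nth_0 mult_eq_0_iff power_eq_0_iff denominators_units simp_thms)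
  have "H $ b $ c = pair_count coeff_y coeff_z (Suc (2 * c)) (Suc (2 * b)) n"
    by (simp add: H_def Es_def Et_def wcount_odd_fps_def fps_sum_nth wcount_fps_const pair_count_def)
  then show ?thesis unfolding H var_x_def by (auto simp: fps_X_power_mult_right_nth)
qed

text \<open>By \<open>pair_count_fps_odd\<close> the quotient is a generating function in
  \<open>x\<close> with constant coefficients; the remaining powers of \<open>s\<close> and
  \<open>t\<close> select \<open>i = c\<close> and \<open>j = b\<close>.\<close>

lemma rhs_term_nth:
  "((1 + var_y * var_x) ^ (i * (j + 1)) * (1 + var_z * var_x) ^ ((i + 1) * j)
        / ((1 - var_y * var_z * var_x) ^ (i * j) * (1 - var_x) ^ ((i + 1) * (j + 1)))
        * var_s ^ i * var_t ^ j) $ a $ b $ c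
   = (if (i, j) = (c, b) then pair_count coeff_y coeff_z (Suc (2 * c)) (Suc (2 * b)) a else 0)"
proof -
  let ?H = "pair_count_fps (fps_const (fps_const coeff_y)) (fps_const (fps_const coeff_z))
    (Suc (2 * i)) (Suc (2 * j))"
  have "?H * ((1 - var_y * var_z * var_x) ^ (i * j) * (1 - var_x) ^ ((i + 1) * (j + 1)))
     = (1 + var_y * var_x) ^ (i * (j + 1)) * (1 + var_z * var_x) ^ ((i + 1) * j)"
    using pair_count_fps_odd[of "fps_const (fps_const coeff_y)" "fps_const (fps_const coeff_z)" i j]
    by (simp add: var_yz var_x_def mult_ac)
  then have Q: "(1 + var_y * var_x) ^ (i * (j + 1)) * (1 + var_z * var_x) ^ ((i + 1) * j)
        / ((1 - var_y * var_z * var_x) ^ (i * j) * (1 - var_x) ^ ((i + 1) * (j + 1))) = ?H"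
    by (intro fps3_divide_eqI)
      (simp_all only: fps3_mult_nth_0 fps3_power_nth_0 mult_eq_0_iff power_eq_0_iff denominators_units simp_thms)
  have st: "var_s ^ i = fps_const (fps_const (fps_X ^ i))" "var_t ^ j = fps_const (fps_X ^ j)"
    by (simp_all add: var_s_def var_t_def fps_const_power)
  have "(?H * var_s ^ i * var_t ^ j) $ a
    = fps_const (fps_const (pair_count coeff_y coeff_z (Suc (2 * i)) (Suc (2 * j)) a) * fps_X ^ i) * fps_X ^ j"
    by (simp add: st pair_count_fps_def pair_count_fps_const)
  then show ?thesis unfolding Q by (auto simp: fps_X_power_mult_right_nth)
qed

theorem theorem4p1:
  fixes lhs_term :: "nat \<Rightarrow> series" and rhs_term :: "nat \<times> nat \<Rightarrow> series"
  defines "lhs_term \<equiv> (\<lambda>n.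
      (1 + var_y * var_s) ^ n * (1 + var_z * var_t) ^ n
        * lpk_des_poly n
            ((1 + var_y)\<^sup>2 * var_s / ((var_y + var_s) * (1 + var_y * var_s)))
            ((1 + var_z)\<^sup>2 * var_t / ((var_z + var_t) * (1 + var_z * var_t)))
            ((var_y + var_s) / (1 + var_y * var_s))
            ((var_z + var_t) / (1 + var_z * var_t))
        / ((1 - var_s) ^ (n + 1) * (1 - var_t) ^ (n + 1))
        * var_x ^ n)"
    and "rhs_term \<equiv> (\<lambda>(i, j).
      (1 + var_y * var_x) ^ (i * (j + 1)) * (1 + var_z * var_x) ^ ((i + 1) * j)
        / ((1 - var_y * var_z * var_x) ^ (i * j) * (1 - var_x) ^ ((i + 1) * (j + 1)))
        * var_s ^ i * var_t ^ j)"
  shows "fps3_summable lhs_term {1..} \<and> fps3_summable rhs_term UNIV \<and>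
    1 / ((1 - var_s) * (1 - var_t)) + fps3_sum lhs_term {1..} = fps3_sum rhs_term UNIV"
proof -
  \<comment> \<open>The common coefficient of \<open>x^a t^b s^c\<close> on both sides.\<close>
  let ?c = "\<lambda>a b c. pair_count coeff_y coeff_z (Suc (2 * c)) (Suc (2 * b)) a"
  have lhs: "lhs_term n $ a $ b $ c = (if n = a then ?c a b c else 0)" for n a b c
    unfolding lhs_term_def by (rule lhs_term_nth)
  have rhs: "rhs_term k $ a $ b $ c = (if k = (c, b) then ?c a b c else 0)" for k a b c
    by (cases k) (simp only: rhs_term_def prod.case rhs_term_nth)
  have "lpk_des_poly 0 y z s t = 1" for y z s t :: series
    by (simp add: lpk_des_poly_def lpk_def des_def ilpk_def ides_def is_left_peak_def is_descent_def)
  \<comment> \<open>The separate summand is the member for \<open>n = 0\<close>, so the left side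
    covers all powers of \<open>x\<close>.\<close>
  then have "lhs_term 0 = 1 / ((1 - var_s) * (1 - var_t))" by (simp add: lhs_term_def)
  then have const: "(1 / ((1 - var_s) * (1 - var_t)) :: series) $ a $ b $ c = (if a = 0 then ?c a b c else 0)" for a b c
    using lhs[of 0 a b c] by auto
  note L = fps3_summable_single[of lhs_term "\<lambda>a b c. a" ?c, OF lhs]
  note R = fps3_summable_single[of rhs_term "\<lambda>a b c. (c, b)" ?c, OF rhs]
  have "1 / ((1 - var_s) * (1 - var_t)) + fps3_sum lhs_term {1..} = fps3_sum rhs_term UNIV"
    by (intro fps_ext) (simp add: const L(2) R(2))
  then show ?thesis using L(1) R(1) by blast
qed

end
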